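(* Let $k\ge 3$ and $\ell\ge 2$ be integers and let $\mathcal N=\{N_1,\ldots,N_\ell\}$ be a collection of $k$-element sets, with $V=\bigcup_{i=1}^\ell N_i$, $n=|V|$ and $m=n-k$. Assume: (i) $\bigcap_{i=1}^\ell N_i=\varnothing$, but $\bigcap_{j\ne i}N_j\neq\varnothing$ for every $i=1,\ldots,\ell$; (ii) for every $S\subseteq V$ with $|S|\ge k+1$ there is a $3$-element set $T\subseteq S$ such that $T\not\subseteq N_i$ for all $i=1,\ldots,\ell$. Then $$n\le \binom{m+2}{2}+6m^{5/3}+3m^{4/3}+9m-3.$$
   Context: Condition (i) says the family is minimal with respect to having empty intersection; condition (ii) says that in the $3$-uniform hypergraph on $V$ whose edges are all $3$-subsets of the sets $N_i$, every clique has at most $k$ vertices. *)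

theory Defs
  imports "HOL-Analysis.Analysis"
begin

end

theory Submission
  imports Defs "HOL-Library.Function_Algebras"
begin

text \<open>
  The complements \<open>M i = V - N i\<close> have \<open>m\<close> elements, and any set of fewer than \<open>m\<close> vertices misses
  a triple that meets every \<open>M i\<close>. Peel \<open>V\<close> off in layers: layer \<open>j\<close> is indexed by a minimal
  subfamily, nested in the previous one, that covers the remaining vertices, and consists of one
  private vertex \<open>u j i\<close> for each of its members \<open>M i\<close>. There are at most \<open>m\<close> layers, so layers with
  at most three members account for at most \<open>3 m\<close> vertices and may be dropped; let \<open>M i\<close>
  take part in \<open>depth i\<close> of the others.

  Call a vertex outside \<open>M i\<close> nearly full for \<open>i\<close> if at most two members of the last layer of \<open>i\<close>
  omit it; over all \<open>i\<close> this happens at most \<open>4 m\<close> times. Exchanging the private vertices of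
  \<open>M i\<close> for the nearly full ones and \<open>C\<close> leaves fewer than \<open>m\<close> vertices as long as \<open>C\<close> has fewer than
  \<open>t = depth i - card (nearly_full i)\<close> elements. Hence the pairs that complete some \<open>u b i\<close> to a
  transversal triple and avoid \<open>M i\<close> and its nearly full vertices have covering number at least \<open>t\<close>,
  and contain a critical subfamily of at least \<open>t\<close> pairs. Each such pair \<open>A\<close> is disjoint from the
  exchanged set of size at most \<open>m - 1\<close> built from a cover \<open>C\<close> of the other pairs. Ordered by
  depth, these form a skew set-pair system, so there are at most \<open>(m + 1) choose 2\<close> of them.
  Altogether \<open>n \<le> ((m + 1) choose 2) + 7 m\<close>, which is stronger than the claim.
\<close>

section \<open>The skew set-pair inequality for pairs\<close>

definition scale_fun :: "real \<Rightarrow> ('b \<Rightarrow> real) \<Rightarrow> 'b \<Rightarrow> real" where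
  "scale_fun c f = (\<lambda>x. c * f x)"

interpretation fun_space: vector_space "scale_fun :: real \<Rightarrow> ('b \<Rightarrow> real) \<Rightarrow> 'b \<Rightarrow> real"
  by unfold_locales (auto simp: scale_fun_def fun_eq_iff algebra_simps)

definition monomials :: "nat \<Rightarrow> (real \<times> real \<Rightarrow> real) set" where
  "monomials s = (\<lambda>(i, j) (p, q). p ^ i * q ^ j) ` (SIGMA i:{..s}. {..s - i})"

text \<open>Each factor is \<open>(w - a) * (w - b)\<close> with \<open>p = a + b\<close> and
  \<open>q = a * b\<close>. In these variables it has degree 1 instead of 2, so
  \<open>card B \<le> s\<close> keeps the total degree within \<open>s\<close>.\<close>

definition root_poly :: "real set \<Rightarrow> real \<times> real \<Rightarrow> real" where
  "root_poly B = (\<lambda>(p, q). \<Prod>w\<in>B. w\<^sup>2 - p * w + q)"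

lemma finite_monomials: "finite (monomials s)"
  by (simp add: monomials_def)

lemma card_monomials_le: "card (monomials s) \<le> (s + 2) choose 2"
proof -
  have "card (monomials s) \<le> card (SIGMA i:{..s}. {..s - i})"
    unfolding monomials_def by (rule card_image_le) simp
  also have "\<dots> = (\<Sum>i\<le>s. Suc (s - i))" by (simp add: card_SigmaI)
  also have "\<dots> = (\<Sum>i\<le>s. Suc i)" using sum.nat_diff_reindex[of Suc "Suc s"] by (simp add: lessThan_Suc_atMost)
  also have "\<dots> = (s + 2) choose 2"
    by (induction s) (simp_all add: numeral_2_eq_2)
  finally show ?thesis .
qed

lemma monomialsI: "i + j \<le> s \<Longrightarrow> (\<lambda>(p, q). p ^ i * q ^ j) \<in> monomials s"
  unfolding monomials_def by (rule image_eqI[where x = "(i, j)"]) auto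

lemma span_monomials_mono: "s \<le> t \<Longrightarrow> fun_space.span (monomials s) \<subseteq> fun_space.span (monomials t)"
  unfolding monomials_def by (intro fun_space.span_mono image_mono) auto

lemma mult_linear_in_span_monomials:
  assumes "g \<in> fun_space.span (monomials s)"
  shows "(\<lambda>(p, q). (w\<^sup>2 - p * w + q) * g (p, q)) \<in> fun_space.span (monomials (Suc s))"
  using assms
proof (induction rule: fun_space.span_induct_alt)
  case base
  have "(\<lambda>(p, q). (w\<^sup>2 - p * w + q) * (0 :: real \<times> real \<Rightarrow> real) (p, q)) = 0"
    by (auto simp: fun_eq_iff)
  then show ?case by (metis fun_space.span_zero)
next
  case (step c f g)
  from step.hyps obtain i j where "i \<le> s" "j \<le> s - i" and f: "f = (\<lambda>(p, q). p ^ i * q ^ j)"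
    unfolding monomials_def by auto
  then have ij: "i + j \<le> s" by simp
  \<comment> \<open>The three terms of the linear factor each raise the degree of the monomial by at
    most one.\<close>
  have "scale_fun (c * w\<^sup>2) (\<lambda>(p, q). p ^ i * q ^ j) + scale_fun (- c * w) (\<lambda>(p, q). p ^ Suc i * q ^ j)
      + scale_fun c (\<lambda>(p, q). p ^ i * q ^ Suc j) + (\<lambda>(p, q). (w\<^sup>2 - p * w + q) * g (p, q))
      \<in> fun_space.span (monomials (Suc s))"
    using ij
    by (intro fun_space.span_add[OF _ step.IH] fun_space.span_add fun_space.span_scale
        fun_space.span_base monomialsI) auto
  also have "scale_fun (c * w\<^sup>2) (\<lambda>(p, q). p ^ i * q ^ j) + scale_fun (- c * w) (\<lambda>(p, q). p ^ Suc i * q ^ j)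
      + scale_fun c (\<lambda>(p, q). p ^ i * q ^ Suc j) + (\<lambda>(p, q). (w\<^sup>2 - p * w + q) * g (p, q))
    = (\<lambda>(p, q). (w\<^sup>2 - p * w + q) * (scale_fun c f + g) (p, q))"
    by (auto simp: fun_eq_iff scale_fun_def f algebra_simps)
  finally show ?case .
qed

lemma root_poly_in_span_monomials:
  assumes "finite B"
  shows "root_poly B \<in> fun_space.span (monomials (card B))"
  using assms
proof (induction rule: finite_induct)
  case empty
  have "root_poly {} = (\<lambda>(p, q). p ^ 0 * q ^ 0)" by (auto simp: root_poly_def)
  also have "\<dots> \<in> fun_space.span (monomials (card ({} :: real set)))"
    by (intro fun_space.span_base monomialsI) auto
  finally show ?case .
next
  case (insert w B)
  have "root_poly (insert w B) = (\<lambda>(p, q). (w\<^sup>2 - p * w + q) * root_poly B (p, q))"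
    using insert.hyps by (auto simp: root_poly_def fun_eq_iff)
  with mult_linear_in_span_monomials[OF insert.IH] insert.hyps show ?case by simp
qed

lemma root_poly_eq_0_iff:
  assumes "finite B"
  shows "root_poly B (a + b, a * b) = 0 \<longleftrightarrow> {a, b} \<inter> B \<noteq> {}"
proof -
  have "w\<^sup>2 - (a + b) * w + a * b = (w - a) * (w - b)" for w
    by (simp add: power2_eq_square algebra_simps)
  with assms show ?thesis by (auto simp: root_poly_def)
qed

text \<open>Code the points by distinct reals; then the polynomial \<open>\<Prod>w\<in>B. w\<^sup>2 - p * w + q\<close> vanishes
  at \<open>p = a + b\<close>, \<open>q = a * b\<close> exactly when \<open>B\<close> meets \<open>{a, b}\<close>, so these polynomials are linearly
  independent in the space of bivariate polynomials of total degree at most \<open>s\<close>.\<close>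

theorem skew_bollobas_pairs:
  fixes A B :: "'x \<Rightarrow> 'a set" and r :: "'x \<Rightarrow> nat"
  assumes X: "finite X"
    and A: "\<And>x. x \<in> X \<Longrightarrow> card (A x) = 2"
    and B: "\<And>x. x \<in> X \<Longrightarrow> finite (B x) \<and> card (B x) \<le> s"
    and disj: "\<And>x. x \<in> X \<Longrightarrow> A x \<inter> B x = {}"
    and meet: "\<And>x y. x \<in> X \<Longrightarrow> y \<in> X \<Longrightarrow> x \<noteq> y \<Longrightarrow> r x \<le> r y \<Longrightarrow> A x \<inter> B y \<noteq> {}"
  shows "card X \<le> (s + 2) choose 2"
proof -
  define U where "U = (\<Union>x\<in>X. A x \<union> B x)"
  have finA: "finite (A x)" if "x \<in> X" for x
    using A[OF that] by (metis card.infinite zero_neq_numeral)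
  have "finite U" using X B finA by (auto simp: U_def)
  then obtain h :: "'a \<Rightarrow> nat" where h: "inj_on h U"
    using finite_imp_inj_to_nat_seg by blast
  define v where "v a = real (h a)" for a
  have v: "inj_on v U" using h by (auto simp: v_def inj_on_def)
  have "\<exists>z. \<forall>y\<in>X. root_poly (v ` B y) z = 0 \<longleftrightarrow> A x \<inter> B y \<noteq> {}" if x: "x \<in> X" for x
  proof -
    obtain a b where ab: "A x = {a, b}" using A[OF x] by (auto simp: card_2_iff)
    have "root_poly (v ` B y) (v a + v b, v a * v b) = 0 \<longleftrightarrow> A x \<inter> B y \<noteq> {}" if y: "y \<in> X" for y
    proof -
      have "v ` A x \<inter> v ` B y = v ` (A x \<inter> B y)"
        using x y by (intro inj_on_image_Int[OF v, symmetric]) (auto simp: U_def)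
      then show ?thesis
        using root_poly_eq_0_iff[of "v ` B y" "v a" "v b"] B[OF y] by (auto simp: ab)
    qed
    then show ?thesis by blast
  qed
  then obtain z where z: "\<And>x y. x \<in> X \<Longrightarrow> y \<in> X \<Longrightarrow> root_poly (v ` B y) (z x) = 0 \<longleftrightarrow> A x \<inter> B y \<noteq> {}"
    by metis
  define f where "f y = root_poly (v ` B y)" for y
  have f_diag: "f x (z x) \<noteq> 0" if "x \<in> X" for x
    using z[OF that that] disj[OF that] by (simp add: f_def)
  have f_off: "f y (z x) = 0" if "x \<in> X" "y \<in> X" "x \<noteq> y" "r x \<le> r y" for x y
    using z[OF that(1,2)] meet[OF that] by (simp add: f_def)
  have inj: "inj_on f X"
  proof (rule inj_onI, rule ccontr)
    \<comment> \<open>By symmetry let \<open>r x \<le> r y\<close>: at \<open>z x\<close> the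
      function \<open>f y\<close> vanishes while \<open>f x\<close> does not.\<close>
    fix x y assume xy: "x \<in> X" "y \<in> X" "f x = f y" "x \<noteq> y"
    then show False using f_diag f_off by (metis nle_le)
  qed
  have indep: "fun_space.independent (f ` X)"
  proof
    assume "fun_space.dependent (f ` X)"
    then obtain c where c: "\<exists>g\<in>f ` X. c g \<noteq> 0" and s0: "(\<Sum>g\<in>f ` X. scale_fun (c g) g) = 0"
      using X by (auto simp: fun_space.dependent_finite)
    \<comment> \<open>Among the indices with nonzero coefficient take \<open>x\<close> of least
      rank. Evaluation at \<open>z x\<close> then kills every other term.\<close>
    define X' where "X' = {x \<in> X. c (f x) \<noteq> 0}"
    have "X' \<noteq> {}" using c by (auto simp: X'_def)
    then obtain x where x: "x \<in> X'" and xmin: "\<And>y. y \<in> X' \<Longrightarrow> r x \<le> r y"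
      using ex_has_least_nat[of "\<lambda>x. x \<in> X'" _ r] by blast
    have xX: "x \<in> X" using x by (simp add: X'_def)
    have "(\<Sum>y\<in>X. scale_fun (c (f y)) (f y)) = 0"
      using s0 by (simp add: sum.reindex[OF inj])
    then have "(\<Sum>y\<in>X. scale_fun (c (f y)) (f y)) (z x) = 0" by simp
    moreover have "(\<Sum>y\<in>Y. scale_fun (c (f y)) (f y)) (z x) = (\<Sum>y\<in>Y. c (f y) * f y (z x))" for Y
      by (induction Y rule: infinite_finite_induct) (auto simp: scale_fun_def)
    ultimately have "0 = (\<Sum>y\<in>X. c (f y) * f y (z x))" by simp
    also have "\<dots> = (\<Sum>y\<in>{x}. c (f y) * f y (z x))"
      using X xX xmin f_off[OF xX] by (intro sum.mono_neutral_right) (auto simp: X'_def)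
    finally show False using x f_diag[OF xX] by (simp add: X'_def)
  qed
  have "f y \<in> fun_space.span (monomials s)" if y: "y \<in> X" for y
  proof -
    have "card (v ` B y) \<le> s" using B[OF y] card_image_le[of "B y" v] by linarith
    then show ?thesis
      using root_poly_in_span_monomials[of "v ` B y"] span_monomials_mono B[OF y]
      by (auto simp: f_def)
  qed
  then have "f ` X \<subseteq> fun_space.span (monomials s)" by blast
  then have "card (f ` X) \<le> card (monomials s)"
    using fun_space.independent_span_bound[OF finite_monomials indep] by simp
  then show ?thesis using card_monomials_le[of s] by (simp add: card_image[OF inj])
qed

section \<open>Layers and critical families\<close>

text \<open>In a cover of least cardinality, dropping \<open>i\<close> uncovers a point of
  \<open>U\<close>, which then lies in \<open>M i\<close> and in no other member.\<close>

lemma obtain_minimal_cover: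
  fixes M :: "'i \<Rightarrow> 'a set"
  assumes "finite I" "U \<subseteq> (\<Union>i\<in>I. M i)"
  obtains J u where "J \<subseteq> I" "U \<subseteq> (\<Union>i\<in>J. M i)"
    "\<And>i. i \<in> J \<Longrightarrow> u i \<in> U \<inter> M i" "\<And>i a. i \<in> J \<Longrightarrow> a \<in> J \<Longrightarrow> a \<noteq> i \<Longrightarrow> u i \<notin> M a"
proof -
  define P where "P J \<longleftrightarrow> J \<subseteq> I \<and> U \<subseteq> (\<Union>i\<in>J. M i)" for J
  obtain J where J: "P J" and Jmin: "\<And>J'. P J' \<Longrightarrow> card J \<le> card J'"
    using assms(2) ex_has_least_nat[of P I card] by (auto simp: P_def)
  have finJ: "finite J" using J assms(1) finite_subset by (auto simp: P_def)
  have "\<exists>x. x \<in> U \<inter> M i \<and> (\<forall>a\<in>J. a \<noteq> i \<longrightarrow> x \<notin> M a)" if i: "i \<in> J" for i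
  proof -
    have "card (J - {i}) < card J" using finJ i by (rule card_Diff1_less)
    then have "\<not> P (J - {i})" using Jmin leD by blast
    then obtain x where "x \<in> U" "x \<notin> (\<Union>a\<in>J - {i}. M a)" using J unfolding P_def by blast
    then show ?thesis using J unfolding P_def by blast
  qed
  then obtain u where "\<And>i. i \<in> J \<Longrightarrow> u i \<in> U \<inter> M i \<and> (\<forall>a\<in>J. a \<noteq> i \<longrightarrow> u i \<notin> M a)"
    by metis
  with J that show ?thesis unfolding P_def by blast
qed

text \<open>Remove the private points of a minimal cover \<open>J\<close> and recurse on the rest
  with \<open>J\<close> as the new index set; it still covers what remains. Once \<open>U\<close> is
  exhausted all later layers are empty.\<close>

lemma obtain_layers:
  fixes M :: "'i \<Rightarrow> 'a set"
  assumes "finite I" "finite U" "U \<subseteq> (\<Union>i\<in>I. M i)"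
  shows "\<exists>L u. L 0 \<subseteq> I \<and> (\<forall>j. L (Suc j) \<subseteq> L j)
    \<and> (\<forall>j. \<forall>i\<in>L j. u j i \<in> M i \<and> (\<forall>a\<in>L j. a \<noteq> i \<longrightarrow> u j i \<notin> M a))
    \<and> bij_betw (\<lambda>(j, i). u j i) (SIGMA j:(UNIV :: nat set). L j) U"
  using assms
proof (induction "card U" arbitrary: I U rule: less_induct)
  case less
  show ?case
  proof (cases "U = {}")
    case True
    then show ?thesis by (intro exI[of _ "\<lambda>_. {}"]) (auto simp: bij_betw_def)
  next
    case False
    obtain J w where J: "J \<subseteq> I" "U \<subseteq> (\<Union>i\<in>J. M i)" and w: "\<And>i. i \<in> J \<Longrightarrow> w i \<in> U \<inter> M i"
      and priv: "\<And>i a. i \<in> J \<Longrightarrow> a \<in> J \<Longrightarrow> a \<noteq> i \<Longrightarrow> w i \<notin> M a"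
      using obtain_minimal_cover[OF less.prems(1,3)] by metis
    have "J \<noteq> {}" using J False by auto
    then have "U - w ` J \<subset> U" using w by blast
    then have "card (U - w ` J) < card U" using less.prems(2) by (rule psubset_card_mono[rotated])
    moreover have "finite J" using J less.prems(1) finite_subset by blast
    moreover have "finite (U - w ` J)" "U - w ` J \<subseteq> (\<Union>i\<in>J. M i)" using less.prems J by auto
    ultimately obtain L u where L: "L 0 \<subseteq> J" "\<forall>j. L (Suc j) \<subseteq> L j"
      and u: "\<forall>j. \<forall>i\<in>L j. u j i \<in> M i \<and> (\<forall>a\<in>L j. a \<noteq> i \<longrightarrow> u j i \<notin> M a)"
      and bij: "bij_betw (\<lambda>(j, i). u j i) (SIGMA j:(UNIV :: nat set). L j) (U - w ` J)"
      using less.hyps[of "U - w ` J" J] by auto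
    define L' where "L' = case_nat J L"
    define u' where "u' = case_nat w u"
    have "inj_on w J" using w priv by (intro inj_onI) (metis IntD2)
    have split: "(SIGMA j:(UNIV :: nat set). L' j)
        = Pair 0 ` J \<union> (\<lambda>(j, i). (Suc j, i)) ` (SIGMA j:(UNIV :: nat set). L j)" (is "?S = ?A \<union> ?B")
    proof (intro equalityI subsetI)
      fix x assume "x \<in> ?S"
      then show "x \<in> ?A \<union> ?B" by (cases x; cases "fst x") (auto simp: L'_def image_iff)
    qed (auto simp: L'_def)
    have "bij_betw (\<lambda>(j, i). u' j i) ?A (w ` J)"
      using \<open>inj_on w J\<close> by (auto simp: bij_betw_def inj_on_def u'_def image_iff)
    moreover have "bij_betw (\<lambda>(j, i). u' j i) ?B (U - w ` J)"
    proof -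
      have "bij_betw (\<lambda>(j, i). (Suc j, i)) (SIGMA j:UNIV. L j) ?B"
        by (auto simp: bij_betw_def inj_on_def)
      then show ?thesis
        by (rule bij_betw_comp_iff[THEN iffD2]) (use bij in \<open>simp add: u'_def comp_def split_def\<close>)
    qed
    ultimately have "bij_betw (\<lambda>(j, i). u' j i) (?A \<union> ?B) (w ` J \<union> (U - w ` J))"
      by (rule bij_betw_combine) auto
    then have "bij_betw (\<lambda>(j, i). u' j i) ?S U" using w split by (auto simp: Un_absorb1 image_subset_iff)
    moreover have "L' 0 \<subseteq> I" "\<forall>j. L' (Suc j) \<subseteq> L' j"
      using J L by (auto simp: L'_def split: nat.split)
    moreover have "\<forall>j. \<forall>i\<in>L' j. u' j i \<in> M i \<and> (\<forall>a\<in>L' j. a \<noteq> i \<longrightarrow> u' j i \<notin> M a)"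
      using u w priv by (auto simp: L'_def u'_def split: nat.split)
    ultimately show ?thesis by blast
  qed
qed

text \<open>By nestedness \<open>i\<close> lies in the layers \<open>0\<close> to \<open>j\<close>,
  which contribute \<open>j + 1\<close> distinct points to \<open>M i\<close>.\<close>

lemma layer_index_less_card:
  fixes M :: "'i \<Rightarrow> 'a set" and L :: "nat \<Rightarrow> 'i set"
  assumes L: "\<And>j. L (Suc j) \<subseteq> L j" and i: "i \<in> L j" and fin: "finite (M i)"
    and mem: "\<And>j. i \<in> L j \<Longrightarrow> u j i \<in> M i"
    and inj: "\<And>j j'. i \<in> L j \<Longrightarrow> i \<in> L j' \<Longrightarrow> u j i = u j' i \<Longrightarrow> j = j'"
  shows "j < card (M i)"
proof -
  have iL: "i \<in> L b" if "b \<le> j" for b using i lift_Suc_antimono_le[of L, OF L that] by blast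
  have "inj_on (\<lambda>b. u b i) {..j}" using iL inj by (metis atMost_iff inj_onI)
  moreover have "(\<lambda>b. u b i) ` {..j} \<subseteq> M i" using iL mem by auto
  ultimately have "card {..j} \<le> card (M i)" using fin by (intro card_inj_on_le)
  then show ?thesis by simp
qed

section \<open>Critical families for the covering number\<close>

text \<open>Take a smallest subfamily that still has no cover of fewer than \<open>t\<close> points.
  One point from each member covers it, so it has at least \<open>t\<close> members; deleting
  \<open>A\<close> creates a small cover \<open>C\<close> of the others, which must miss
  \<open>A\<close>.\<close>

lemma obtain_critical_subfamily:
  fixes F :: "'a set set"
  assumes "finite F" "{} \<notin> F"
    and "\<And>C. finite C \<Longrightarrow> card C < t \<Longrightarrow> \<exists>A\<in>F. A \<inter> C = {}"
  obtains E where "E \<subseteq> F" "t \<le> card E"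
    "\<And>A. A \<in> E \<Longrightarrow> \<exists>C. finite C \<and> card C < t \<and> A \<inter> C = {} \<and> (\<forall>A'\<in>E. A' \<noteq> A \<longrightarrow> A' \<inter> C \<noteq> {})"
proof -
  define P where "P E \<longleftrightarrow> E \<subseteq> F \<and> (\<forall>C. finite C \<longrightarrow> card C < t \<longrightarrow> (\<exists>A\<in>E. A \<inter> C = {}))" for E
  have "P F" using assms(3) by (auto simp: P_def)
  then obtain E where E: "P E" and Emin: "\<And>E'. P E' \<Longrightarrow> card E \<le> card E'"
    using ex_has_least_nat[of P F card] by auto
  have EF: "E \<subseteq> F" using E by (simp add: P_def)
  have finE: "finite E" using EF assms(1) finite_subset by blast
  have "t \<le> card E"
  proof (rule ccontr)
    assume "\<not> t \<le> card E"
    moreover obtain pick where pick: "\<And>A. A \<in> E \<Longrightarrow> pick A \<in> A"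
      using EF assms(2) by (metis all_not_in_conv subsetD)
    ultimately have "card (pick ` E) < t" using card_image_le[OF finE, of pick] by linarith
    then obtain A where "A \<in> E" "A \<inter> pick ` E = {}" using E finE by (auto simp: P_def)
    then show False using pick by blast
  qed
  moreover have "\<exists>C. finite C \<and> card C < t \<and> A \<inter> C = {} \<and> (\<forall>A'\<in>E. A' \<noteq> A \<longrightarrow> A' \<inter> C \<noteq> {})"
    if A: "A \<in> E" for A
  proof -
    have "card (E - {A}) < card E" using finE A by (rule card_Diff1_less)
    then have "\<not> P (E - {A})" using Emin leD by blast
    then obtain C where C: "finite C" "card C < t" "\<forall>A'\<in>E - {A}. A' \<inter> C \<noteq> {}"
      using EF by (auto simp: P_def)
    moreover obtain A' where "A' \<in> E" "A' \<inter> C = {}" using E C by (auto simp: P_def)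
    ultimately show ?thesis by blast
  qed
  ultimately show ?thesis using that EF by blast
qed


section \<open>Exchanging private vertices\<close>

text \<open>The layers \<open>K\<close> have size at least four or are empty. Hence, if at most two
  members of a nonempty layer omit a vertex, at least half of them contain it, and discarding two
  members never exhausts such a layer.\<close>

locale layered_transversals =
  fixes V :: "'a set" and M :: "'i \<Rightarrow> 'a set" and m :: nat
    and K :: "nat \<Rightarrow> 'i set" and u :: "nat \<Rightarrow> 'i \<Rightarrow> 'a"
  assumes finite_V: "finite V"
    and M_subset: "i \<in> K 0 \<Longrightarrow> M i \<subseteq> V"
    and card_M: "i \<in> K 0 \<Longrightarrow> card (M i) = m"
    and triple: "finite Z \<Longrightarrow> card Z < m \<Longrightarrow> \<exists>T\<subseteq>V - Z. card T = 3 \<and> (\<forall>i\<in>K 0. T \<inter> M i \<noteq> {})"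
    and finite_K0: "finite (K 0)"
    and K_Suc: "K (Suc j) \<subseteq> K j"
    and K_big: "K j \<noteq> {} \<Longrightarrow> 4 \<le> card (K j)"
    and u_mem: "i \<in> K j \<Longrightarrow> u j i \<in> M i"
    and u_private: "i \<in> K j \<Longrightarrow> a \<in> K j \<Longrightarrow> a \<noteq> i \<Longrightarrow> u j i \<notin> M a"
    and u_inj: "i \<in> K j \<Longrightarrow> i \<in> K j' \<Longrightarrow> u j i = u j' i \<Longrightarrow> j = j'"
begin

lemma K_antimono: "j \<le> j' \<Longrightarrow> K j' \<subseteq> K j"
  using K_Suc by (rule lift_Suc_antimono_le)

lemma K_subset_K0: "K j \<subseteq> K 0"
  by (rule K_antimono) simp

lemma finite_K: "finite (K j)"
  using finite_K0 K_subset_K0 by (rule finite_subset[rotated])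

lemma finite_M: "i \<in> K 0 \<Longrightarrow> finite (M i)"
  using M_subset finite_V finite_subset by blast

lemma level_less:
  assumes "i \<in> K j"
  shows "j < m"
proof -
  have i: "i \<in> K 0" using assms K_subset_K0 by blast
  show ?thesis
    using layer_index_less_card[of K i j M u, OF K_Suc assms finite_M[OF i] u_mem u_inj] card_M[OF i]
    by simp
qed

section \<open>Depth, last layers and own vertices\<close>

definition depth :: "'i \<Rightarrow> nat" where
  "depth i = card {j. i \<in> K j}"

lemma mem_K_iff: "i \<in> K j \<longleftrightarrow> j < depth i"
proof -
  \<comment> \<open>Finiteness ensures that \<open>card\<close> does not take its default value
    0.\<close>
  have fin: "finite {j. i \<in> K j}"
    by (rule finite_subset[of _ "{..<m}"]) (auto dest: level_less)
  show ?thesis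
  proof
    assume "i \<in> K j"
    then have "{..j} \<subseteq> {j. i \<in> K j}" using K_antimono by blast
    then have "card {..j} \<le> depth i" unfolding depth_def by (rule card_mono[OF fin])
    then show "j < depth i" by simp
  next
    assume j: "j < depth i"
    show "i \<in> K j"
    proof (rule ccontr)
      assume "i \<notin> K j"
      then have "b < j" if "i \<in> K b" for b using that K_antimono[of j b] by (meson not_less subsetD)
      then have "{j. i \<in> K j} \<subseteq> {..<j}" by blast
      then have "depth i \<le> card {..<j}" unfolding depth_def by (rule card_mono[rotated]) simp
      then show False using j by simp
    qed
  qed
qed

text \<open>For \<open>i\<close> outside \<open>K 0\<close> the depth is 0 and truncated subtraction
  gives \<open>K 0\<close>.\<close>

definition last_layer :: "'i \<Rightarrow> 'i set" where
  "last_layer i = K (depth i - 1)"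

lemma mem_last_layer: "i \<in> K 0 \<Longrightarrow> i \<in> last_layer i"
  by (simp add: last_layer_def mem_K_iff)

lemma last_layer_subset: "j < depth i \<Longrightarrow> last_layer i \<subseteq> K j"
  unfolding last_layer_def by (rule K_antimono) simp

lemma finite_last_layer: "finite (last_layer i)"
  by (simp add: last_layer_def finite_K)

lemma card_last_layer: "i \<in> K 0 \<Longrightarrow> 4 \<le> card (last_layer i)"
  using mem_last_layer unfolding last_layer_def by (intro K_big) auto

lemma last_layer_other:
  assumes "i \<in> K 0"
  obtains a where "a \<in> last_layer i" "a \<noteq> i" "a \<noteq> i'"
proof -
  have "card {i, i'} \<le> 2" by (simp add: card_insert_if)
  then have "\<not> last_layer i \<subseteq> {i, i'}"
    using card_last_layer[OF assms] card_mono[of "{i, i'}" "last_layer i"] by auto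
  then show ?thesis using that by blast
qed

definition own :: "'i \<Rightarrow> 'a set" where
  "own i = (\<lambda>b. u b i) ` {..<depth i}"

lemma own_subset: "own i \<subseteq> M i"
  using u_mem by (auto simp: own_def mem_K_iff)

lemma card_own: "card (own i) = depth i"
  unfolding own_def using u_inj by (subst card_image) (auto intro!: inj_onI simp: mem_K_iff)

text \<open>The last layer lies inside every layer containing \<open>i\<close>, so its members serve
  as common competitors for all own vertices.\<close>

lemma own_private:
  assumes "x \<in> own i" "a \<in> last_layer i" "a \<noteq> i"
  shows "x \<notin> M a"
proof -
  obtain b where b: "b < depth i" "x = u b i" using assms(1) by (auto simp: own_def)
  then show ?thesis using u_private[of i b a] last_layer_subset[OF b(1)] assms by (auto simp: mem_K_iff)
qed

section \<open>Nearly full vertices and the exchange\<close>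

text \<open>For \<open>i\<close> in \<open>K 0\<close> one of the two omitting members is
  \<open>i\<close> itself. The second leaves room for the index \<open>i'\<close> whose link is
  compared with \<open>i\<close> in \<open>links_meet\<close>.\<close>

definition nearly_full :: "'i \<Rightarrow> 'a set" where
  "nearly_full i = {y \<in> V. y \<notin> M i \<and> card {a \<in> last_layer i. y \<notin> M a} \<le> 2}"

lemma finite_nearly_full: "finite (nearly_full i)"
  using finite_V by (simp add: nearly_full_def)

lemma nearly_fullI:
  assumes "y \<in> V" "y \<notin> M i" "\<And>a. a \<in> last_layer i \<Longrightarrow> a \<noteq> i \<Longrightarrow> a \<noteq> i' \<Longrightarrow> y \<in> M a"
  shows "y \<in> nearly_full i"
proof -
  have "card {a \<in> last_layer i. y \<notin> M a} \<le> card {i, i'}"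
    using assms(3) by (intro card_mono) auto
  also have "\<dots> \<le> 2" by (simp add: card_insert_if)
  finally show ?thesis using assms by (simp add: nearly_full_def)
qed

text \<open>Removing \<open>own i\<close> saves \<open>depth i\<close> elements, and strictly fewer
  are added. If the truncated difference is 0, no \<open>C\<close> qualifies.\<close>

lemma card_exchange:
  assumes i: "i \<in> K 0" and C: "finite C" "card C < depth i - card (nearly_full i)"
  shows "finite ((M i - own i) \<union> nearly_full i \<union> C) \<and> card ((M i - own i) \<union> nearly_full i \<union> C) < m"
proof -
  have "finite (own i)" by (simp add: own_def)
  then have "card (M i - own i) = m - depth i"
    using card_Diff_subset[of "own i" "M i"] own_subset card_own card_M[OF i] by simp
  moreover have "depth i \<le> m"
    using card_mono[OF finite_M[OF i] own_subset] card_own card_M[OF i] by simp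
  moreover have "card ((M i - own i) \<union> nearly_full i \<union> C)
      \<le> card (M i - own i) + card (nearly_full i) + card C"
    using card_Un_le[of "(M i - own i) \<union> nearly_full i" C] card_Un_le[of "M i - own i" "nearly_full i"]
    by linarith
  ultimately show ?thesis using C finite_M[OF i] finite_nearly_full[of i] by auto
qed

text \<open>Let \<open>i\<close> be an owner of least depth. Every owner then belongs to the last
  layer of \<open>i\<close> and omits \<open>y\<close>, and at most two members there do so.\<close>

lemma card_nearly_full_owners:
  "card {i \<in> K 0. y \<in> nearly_full i} \<le> 2"
proof (cases "{i \<in> K 0. y \<in> nearly_full i} = {}")
  case False
  then obtain i0 where "i0 \<in> K 0 \<and> y \<in> nearly_full i0" by blast
  from ex_has_least_nat[of "\<lambda>i. i \<in> K 0 \<and> y \<in> nearly_full i", OF this, of depth]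
  obtain i where i: "i \<in> K 0" "y \<in> nearly_full i"
    and imin: "\<And>a. a \<in> K 0 \<Longrightarrow> y \<in> nearly_full a \<Longrightarrow> depth i \<le> depth a" by blast
  have "{i \<in> K 0. y \<in> nearly_full i} \<subseteq> {a \<in> last_layer i. y \<notin> M a}"
  proof clarify
    fix a assume a: "a \<in> K 0" "y \<in> nearly_full a"
    have "depth i - 1 < depth a" using imin[OF a] i by (simp add: mem_K_iff)
    then show "a \<in> last_layer i \<and> y \<notin> M a"
      using a by (simp add: last_layer_def mem_K_iff nearly_full_def)
  qed
  then have "card {i \<in> K 0. y \<in> nearly_full i} \<le> card {a \<in> last_layer i. y \<notin> M a}"
    using finite_last_layer by (intro card_mono) auto
  then show ?thesis using i by (simp add: nearly_full_def)
qed (metis card.empty zero_le)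

text \<open>The last layer \<open>L\<close> of an index of greatest depth lies in all other last
  layers. So each vertex in question is in at least half of the sets \<open>M a\<close> with
  \<open>a\<close> in \<open>L\<close>, and these have \<open>m\<close> elements each; count
  incidences.\<close>

lemma card_Union_nearly_full: "card (\<Union>i\<in>K 0. nearly_full i) \<le> 2 * m"
proof (cases "K 0 = {}")
  case False
  define Y where "Y = (\<Union>i\<in>K 0. nearly_full i)"
  have finY: "finite Y" using finite_K0 finite_nearly_full by (auto simp: Y_def)
  have "Max (depth ` K 0) \<in> depth ` K 0" using False finite_K0 by (intro Max_in) auto
  then obtain i where i: "i \<in> K 0" and "depth i = Max (depth ` K 0)" by auto
  then have imax: "depth a \<le> depth i" if "a \<in> K 0" for a using that finite_K0 by simp
  define L where "L = last_layer i"
  have finL: "finite L" and L4: "4 \<le> card L" and LK: "L \<subseteq> K 0"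
    using finite_last_layer card_last_layer[OF i] K_subset_K0 by (auto simp: L_def last_layer_def)
  have "card L \<le> 2 * card {a \<in> L. y \<in> M a}" if y: "y \<in> Y" for y
  proof -
    obtain a where a: "a \<in> K 0" "y \<in> nearly_full a" using y by (auto simp: Y_def)
    have "L \<subseteq> last_layer a" unfolding L_def last_layer_def using imax[OF a(1)] by (intro K_antimono) simp
    then have "card {a \<in> L. y \<notin> M a} \<le> card {b \<in> last_layer a. y \<notin> M b}"
      using finite_last_layer by (intro card_mono) auto
    also have "\<dots> \<le> 2" using a by (simp add: nearly_full_def)
    finally have "card {a \<in> L. y \<notin> M a} \<le> 2" .
    moreover have "card L = card {a \<in> L. y \<in> M a} + card {a \<in> L. y \<notin> M a}"
      using finL by (subst card_Un_disjoint[symmetric]) (auto intro!: arg_cong[where f = card])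
    ultimately show ?thesis using L4 by linarith
  qed
  then have "(\<Sum>y\<in>Y. card L) \<le> (\<Sum>y\<in>Y. 2 * card {a \<in> L. y \<in> M a})" by (rule sum_mono)
  also have "\<dots> = 2 * (\<Sum>y\<in>Y. card {a \<in> L. y \<in> M a})" by (simp add: sum_distrib_left)
  also have "(\<Sum>y\<in>Y. card {a \<in> L. y \<in> M a}) = (\<Sum>a\<in>L. card {y \<in> Y. y \<in> M a})"
    using finY finL by (rule sum_multicount_gen) simp
  also have "\<dots> \<le> (\<Sum>a\<in>L. m)"
  proof (rule sum_mono)
    fix a assume "a \<in> L"
    then have "a \<in> K 0" using LK by blast
    then show "card {y \<in> Y. y \<in> M a} \<le> m"
      using card_M[of a] finite_M[of a] card_mono[of "M a" "{y \<in> Y. y \<in> M a}"] by auto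
  qed
  finally have "card Y * card L \<le> (2 * m) * card L" by (simp add: algebra_simps)
  then show ?thesis using L4 by (simp add: Y_def)
qed simp

lemma sum_card_nearly_full: "(\<Sum>i\<in>K 0. card (nearly_full i)) \<le> 4 * m"
proof -
  define Y where "Y = (\<Union>i\<in>K 0. nearly_full i)"
  have finY: "finite Y" using finite_K0 finite_nearly_full by (auto simp: Y_def)
  have "(\<Sum>i\<in>K 0. card (nearly_full i)) = (\<Sum>i\<in>K 0. card {y \<in> Y. y \<in> nearly_full i})"
    by (intro sum.cong refl arg_cong[where f = card]) (auto simp: Y_def)
  also have "\<dots> = (\<Sum>y\<in>Y. card {i \<in> K 0. y \<in> nearly_full i})"
    using finite_K0 finY by (rule sum_multicount_gen) simp
  also have "\<dots> \<le> (\<Sum>y\<in>Y. 2)" using card_nearly_full_owners by (intro sum_mono) auto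
  also have "\<dots> \<le> 4 * m" using card_Union_nearly_full by (simp add: Y_def)
  finally show ?thesis .
qed

section \<open>Link pairs and their intersections\<close>

text \<open>In the 3-uniform hypergraph of transversal triples, this is the union of the links of
  the own vertices of \<open>i\<close>, restricted to pairs outside \<open>M i\<close> and
  \<open>nearly_full i\<close>.\<close>

definition links :: "'i \<Rightarrow> 'a set set" where
  "links i = {A. A \<subseteq> V \<and> card A = 2 \<and> A \<inter> (M i \<union> nearly_full i) = {} \<and>
     (\<exists>b<depth i. \<forall>a\<in>K 0. insert (u b i) A \<inter> M a \<noteq> {})}"

text \<open>A transversal triple avoiding the exchanged set meets \<open>M i\<close> only in own
  vertices. If it has exactly one, the other two vertices form the link.\<close>

lemma links_avoid_small_sets:
  assumes i: "i \<in> K 0" and C: "finite C" "card C < depth i - card (nearly_full i)"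
  shows "\<exists>A\<in>links i. A \<inter> C = {}"
proof -
  define Z where "Z = (M i - own i) \<union> nearly_full i \<union> C"
  have "finite Z \<and> card Z < m" unfolding Z_def by (rule card_exchange[OF assms])
  then obtain T where T: "T \<subseteq> V - Z" "card T = 3" "\<forall>a\<in>K 0. T \<inter> M a \<noteq> {}"
    using triple[of Z] by auto
  obtain x where x: "x \<in> T" "x \<in> M i" using T(3) i by blast
  have own: "y \<in> own i" if "y \<in> T" "y \<in> M i" for y using that T(1) by (auto simp: Z_def)
  have finT: "finite T" using T(2) by (metis card.infinite zero_neq_numeral)
  have card2: "card (T - {x}) = 2" using T(2) x(1) finT by simp
  have "(T - {x}) \<inter> M i = {}"
  proof (rule ccontr)
    \<comment> \<open>Two own vertices \<open>x\<close>, \<open>y\<close> would leave the third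
      vertex \<open>z\<close> to meet all other members of the last layer. That makes
      \<open>z\<close> nearly full, but \<open>T\<close> avoids such vertices.\<close>
    assume "(T - {x}) \<inter> M i \<noteq> {}"
    then obtain y where y: "y \<in> T" "y \<noteq> x" "y \<in> M i" by blast
    have "card (T - {x} - {y}) = 1" using card2 y finT by simp
    then obtain z where z: "T - {x} - {y} = {z}" by (auto simp: card_1_singleton_iff)
    then have Teq: "T = {x, y, z}" using x y by auto
    have zM: "z \<in> M a" if a: "a \<in> last_layer i" "a \<noteq> i" for a
    proof -
      have "a \<in> K 0" using a K_subset_K0 by (auto simp: last_layer_def)
      then obtain w where "w \<in> T" "w \<in> M a" using T(3) by blast
      moreover have "x \<notin> M a" "y \<notin> M a" using own_private own x y a by auto
      ultimately show ?thesis using Teq by auto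
    qed
    obtain a where "a \<in> last_layer i" "a \<noteq> i" using last_layer_other[OF i] by metis
    then have "z \<notin> own i" using zM own_private by blast
    moreover have "z \<in> T" using Teq by simp
    ultimately have "z \<notin> M i" using own by blast
    moreover have "z \<in> V" using \<open>z \<in> T\<close> T by blast
    ultimately have "z \<in> nearly_full i" using zM by (intro nearly_fullI[of z i i])
    then show False using \<open>z \<in> T\<close> T by (auto simp: Z_def)
  qed
  moreover obtain b where b: "b < depth i" "x = u b i" using own[OF x] by (auto simp: own_def)
  moreover have "insert (u b i) (T - {x}) = T" using b x by blast
  ultimately have "T - {x} \<in> links i"
    using T card2 by (auto simp: links_def Z_def intro!: exI[of _ b])
  moreover have "(T - {x}) \<inter> C = {}" using T by (auto simp: Z_def)
  ultimately show ?thesis by blast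
qed

text \<open>The vertex \<open>u b i'\<close> is private in \<open>K b\<close>, so the pair
  \<open>A\<close> alone meets all other members there, including \<open>M i\<close>. If it did so
  in an own vertex of \<open>i\<close>, its other vertex would have to meet the last layer of
  \<open>i\<close> outside \<open>i\<close> and \<open>i'\<close>, and so would be nearly
  full.\<close>

lemma links_meet:
  assumes i: "i \<in> K 0" and i': "i' \<in> K 0" "i' \<noteq> i" "depth i' \<le> depth i" and A: "A \<in> links i'"
  shows "A \<inter> ((M i - own i) \<union> nearly_full i) \<noteq> {}"
proof
  assume empty: "A \<inter> ((M i - own i) \<union> nearly_full i) = {}"
  obtain b where b: "b < depth i'" and hit: "\<forall>a\<in>K 0. insert (u b i') A \<inter> M a \<noteq> {}"
    using A by (auto simp: links_def)
  have AM: "A \<inter> M a \<noteq> {}" if a: "a \<in> K b" "a \<noteq> i'" for a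
  proof -
    have "u b i' \<notin> M a" using u_private[of i' b a] a b by (simp add: mem_K_iff)
    then show ?thesis using hit a K_subset_K0 by blast
  qed
  have "i \<in> K b" using b i' by (simp add: mem_K_iff)
  then obtain x where x: "x \<in> A" "x \<in> M i" using AM i' by blast
  then have xown: "x \<in> own i" using empty by blast
  have "card (A - {x}) = 1"
    using A x by (simp add: links_def card_Diff_singleton)
  then obtain y where y: "A - {x} = {y}" by (auto simp: card_1_singleton_iff)
  then have Aeq: "A = {x, y}" using x by auto
  have yM: "y \<in> M a" if a: "a \<in> last_layer i" "a \<noteq> i" "a \<noteq> i'" for a
  proof -
    have "b < depth i" using b i' by simp
    then have "a \<in> K b" using a last_layer_subset by blast
    then obtain w where "w \<in> A" "w \<in> M a" using AM a by blast
    moreover have "x \<notin> M a" using own_private xown a by blast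
    ultimately show ?thesis using Aeq by auto
  qed
  have "y \<in> A" using Aeq by simp
  obtain a where "a \<in> last_layer i" "a \<noteq> i" "a \<noteq> i'" using last_layer_other[OF i] by metis
  then have "y \<notin> own i" using yM own_private by blast
  then have "y \<notin> M i" using empty \<open>y \<in> A\<close> by blast
  moreover have "y \<in> V" using \<open>y \<in> A\<close> A by (auto simp: links_def)
  ultimately have "y \<in> nearly_full i" using yM by (intro nearly_fullI[of y i i'])
  then show False using empty \<open>y \<in> A\<close> by blast
qed

lemma finite_links: "finite (links i)"
  using finite_V by (intro finite_subset[of "links i" "Pow V"]) (auto simp: links_def)

text \<open>The critical links of all indices, paired with their exchanged sets and ranked by depth,
  form one skew system. Its size bounds the sum of the depths up to the nearly full
  vertices.\<close>

lemma sum_depth_le: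
  assumes "0 < m"
  shows "(\<Sum>i\<in>K 0. depth i) \<le> ((m + 1) choose 2) + 4 * m"
proof -
  let ?t = "\<lambda>i. depth i - card (nearly_full i)"
  have "\<exists>E. E \<subseteq> links i \<and> ?t i \<le> card E \<and> (\<forall>A\<in>E. \<exists>C. finite C \<and> card C < ?t i \<and> A \<inter> C = {} \<and>
      (\<forall>A'\<in>E. A' \<noteq> A \<longrightarrow> A' \<inter> C \<noteq> {}))" if i: "i \<in> K 0" for i
  proof (rule obtain_critical_subfamily[OF finite_links])
    show "{} \<notin> links i" by (simp add: links_def)
    show "\<exists>A\<in>links i. A \<inter> C = {}" if "finite C" "card C < ?t i" for C
      using links_avoid_small_sets[OF i that] .
  qed blast
  then obtain E where E: "\<And>i. i \<in> K 0 \<Longrightarrow> E i \<subseteq> links i" "\<And>i. i \<in> K 0 \<Longrightarrow> ?t i \<le> card (E i)"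
    and ex: "\<And>i A. i \<in> K 0 \<Longrightarrow> A \<in> E i \<Longrightarrow> \<exists>C. finite C \<and> card C < ?t i \<and> A \<inter> C = {} \<and>
      (\<forall>A'\<in>E i. A' \<noteq> A \<longrightarrow> A' \<inter> C \<noteq> {})"
    by metis
  obtain C where C: "\<And>i A. i \<in> K 0 \<Longrightarrow> A \<in> E i \<Longrightarrow> finite (C i A) \<and> card (C i A) < ?t i \<and>
      A \<inter> C i A = {} \<and> (\<forall>A'\<in>E i. A' \<noteq> A \<longrightarrow> A' \<inter> C i A \<noteq> {})"
    using ex by metis
  have finE: "finite (E i)" if "i \<in> K 0" for i using E(1)[OF that] finite_links finite_subset by blast
  define X where "X = (SIGMA i:K 0. E i)"
  define B where "B = (\<lambda>(i, A). (M i - own i) \<union> nearly_full i \<union> C i A)"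
  have "card X \<le> (m - 1 + 2) choose 2"
  proof (rule skew_bollobas_pairs[of X snd B "m - 1" "\<lambda>x. depth (fst x)"])
    show "finite X" using finite_K0 finE by (auto simp: X_def)
    fix x assume "x \<in> X"
    then obtain i A where x: "x = (i, A)" and i: "i \<in> K 0" and A: "A \<in> E i" by (auto simp: X_def)
    have Al: "A \<in> links i" using E(1)[OF i] A by blast
    show "card (snd x) = 2" using Al by (simp add: x links_def)
    show "snd x \<inter> B x = {}" using Al C[OF i A] by (auto simp: x B_def links_def)
    have "finite (B x) \<and> card (B x) < m"
      unfolding B_def x prod.case using C[OF i A] by (intro card_exchange[OF i]) auto
    then show "finite (B x) \<and> card (B x) \<le> m - 1" by auto
    fix y assume "y \<in> X" "x \<noteq> y" and le: "depth (fst x) \<le> depth (fst y)"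
    then obtain i' A' where y: "y = (i', A')" and i': "i' \<in> K 0" and A': "A' \<in> E i'"
      and ne: "(i, A) \<noteq> (i', A')" by (auto simp: X_def x)
    show "snd x \<inter> B y \<noteq> {}"
    \<comment> \<open>For equal indices the cover from criticality provides the intersection; for
      different ones the exchanged part alone does.\<close>
    proof (cases "i = i'")
      case True
      then show ?thesis using C[OF i' A'] A ne by (auto simp: x y B_def)
    next
      case False
      then have "A \<inter> ((M i' - own i') \<union> nearly_full i') \<noteq> {}"
        using links_meet[OF i' i _ _ Al] le by (simp add: x y)
      then show ?thesis by (auto simp: x y B_def)
    qed
  qed
  moreover have "card X = (\<Sum>i\<in>K 0. card (E i))"
    unfolding X_def using finite_K0 finE by (intro card_SigmaI) auto
  \<comment> \<open>This also holds where the difference defining \<open>?t i\<close> is truncated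
    to 0.\<close>
  moreover have "(\<Sum>i\<in>K 0. depth i) \<le> (\<Sum>i\<in>K 0. card (E i) + card (nearly_full i))"
    using E(2) by (intro sum_mono) (simp add: le_diff_conv)
  ultimately show ?thesis using assms sum_card_nearly_full by (simp add: sum.distrib)
qed

end


section \<open>The bound\<close>

theorem card_le_of_minimum_transversals:
  fixes M :: "'i \<Rightarrow> 'a set"
  assumes I: "finite I" and V: "finite V" "V = (\<Union>i\<in>I. M i)"
    and card_M: "\<And>i. i \<in> I \<Longrightarrow> card (M i) = m" and m: "0 < m"
    and triple: "\<And>Z. finite Z \<Longrightarrow> card Z < m \<Longrightarrow> \<exists>T\<subseteq>V - Z. card T = 3 \<and> (\<forall>i\<in>I. T \<inter> M i \<noteq> {})"
  shows "card V \<le> ((m + 1) choose 2) + 7 * m"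
proof -
  obtain L u where L0: "L 0 \<subseteq> I" and L_Suc: "\<And>j. L (Suc j) \<subseteq> L j"
    and u_mem: "\<And>i j. i \<in> L j \<Longrightarrow> u j i \<in> M i"
    and u_private: "\<And>i j a. i \<in> L j \<Longrightarrow> a \<in> L j \<Longrightarrow> a \<noteq> i \<Longrightarrow> u j i \<notin> M a"
    and bij: "bij_betw (\<lambda>(j, i). u j i) (SIGMA j:(UNIV :: nat set). L j) V"
    using obtain_layers[OF I V(1) equalityD1[OF V(2)]] by metis
  have L_anti: "j \<le> j' \<Longrightarrow> L j' \<subseteq> L j" for j j'
    using L_Suc by (rule lift_Suc_antimono_le)
  have LI: "L j \<subseteq> I" for j using L_anti[of 0 j] L0 by auto
  have finL: "finite (L j)" for j using LI I by (rule finite_subset)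
  have u_inj: "j = j'" if "i \<in> L j" "i \<in> L j'" "u j i = u j' i" for i j j'
    using bij_betw_imp_inj_on[OF bij, THEN inj_onD, of "(j, i)" "(j', i)"] that by auto
  have finM: "finite (M i)" if "i \<in> I" for i
    using that V by (auto intro: finite_subset)
  have L_less: "j < m" if i: "i \<in> L j" for i j
  proof -
    have "i \<in> I" using i LI by blast
    then show ?thesis
      using layer_index_less_card[of L i j M u, OF L_Suc i finM u_mem u_inj] card_M by simp
  qed
  \<comment> \<open>Layer sizes do not increase, so the small layers form a tail and emptying them
    preserves nestedness.\<close>
  define K where "K j = (if 4 \<le> card (L j) then L j else {})" for j
  have KL: "K j \<subseteq> L j" for j by (simp add: K_def)
  interpret layered_transversals V M m K u
  proof
    show "finite V" by (rule V)
    show "M i \<subseteq> V" if "i \<in> K 0" for i using that KL LI V by blast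
    show "card (M i) = m" if "i \<in> K 0" for i using that KL LI card_M by blast
    show "\<exists>T\<subseteq>V - Z. card T = 3 \<and> (\<forall>i\<in>K 0. T \<inter> M i \<noteq> {})" if "finite Z" "card Z < m" for Z
      using triple[OF that] KL LI by (meson subsetD)
    show "finite (K 0)" using KL finL by (rule finite_subset)
    show "K (Suc j) \<subseteq> K j" for j
      using card_mono[OF finL L_Suc, of j] L_Suc[of j] by (auto simp: K_def)
    show "4 \<le> card (K j)" if "K j \<noteq> {}" for j using that by (simp add: K_def split: if_splits)
    show "u j i \<in> M i" if "i \<in> K j" for i j using that KL u_mem by blast
    show "u j i \<notin> M a" if "i \<in> K j" "a \<in> K j" "a \<noteq> i" for i j a
      using that KL u_private by blast
    show "j = j'" if "i \<in> K j" "i \<in> K j'" "u j i = u j' i" for i j j'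
      using that KL u_inj by blast
  qed
  have sig: "(SIGMA j:(UNIV :: nat set). L j) = (SIGMA j:{..<m}. L j)" using L_less by auto
  have "card V = card (SIGMA j:{..<m}. L j)" using bij_betw_same_card[OF bij] by (simp add: sig)
  also have "\<dots> = (\<Sum>j<m. card (L j))" using finL by (intro card_SigmaI) auto
  also have "\<dots> \<le> (\<Sum>j<m. card (K j) + 3)" by (rule sum_mono) (simp add: K_def)
  also have "\<dots> = (\<Sum>j<m. card {i \<in> K 0. i \<in> K j}) + 3 * m"
  proof -
    have "{i \<in> K 0. i \<in> K j} = K j" for j using K_subset_K0 by blast
    then show ?thesis by (simp add: sum.distrib)
  qed
  \<comment> \<open>Counting pairs of a level and an index the other way turns layer sizes into
    depths.\<close>
  also have "(\<Sum>j<m. card {i \<in> K 0. i \<in> K j}) = (\<Sum>i\<in>K 0. card {j \<in> {..<m}. i \<in> K j})"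
    using finite_K0 by (intro sum_multicount_gen) auto
  also have "\<dots> = (\<Sum>i\<in>K 0. depth i)"
    unfolding depth_def using level_less by (intro sum.cong refl arg_cong[where f = card]) blast
  also have "\<dots> + 3 * m \<le> ((m + 1) choose 2) + 7 * m" using sum_depth_le[OF m] by simp
  finally show ?thesis by simp
qed

theorem theorem5:
  fixes k l :: nat and N :: "nat \<Rightarrow> 'a set"
  assumes "k \<ge> 3" and "l \<ge> 2"
    and card_N: "\<forall>i<l. finite (N i) \<and> card (N i) = k"
    and empty_inter: "(\<Inter>i\<in>{..<l}. N i) = {}"
    and minimal: "\<forall>i<l. (\<Inter>j\<in>{..<l} - {i}. N j) \<noteq> {}"
    and no_big_clique: "\<forall>S \<subseteq> (\<Union>i\<in>{..<l}. N i). card S \<ge> k + 1 \<longrightarrow>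
          (\<exists>T \<subseteq> S. card T = 3 \<and> (\<forall>i<l. \<not> T \<subseteq> N i))"
  shows "let n = card (\<Union>i\<in>{..<l}. N i); m = n - k in
         real n \<le> real ((m + 2) choose 2) + 6 * real m powr (5/3) + 3 * real m powr (4/3)
                   + 9 * real m - 3"
proof -
  define V where "V = (\<Union>i\<in>{..<l}. N i)"
  define m where "m = card V - k"
  have finV: "finite V" using card_N by (auto simp: V_def)
  have NV: "N i \<subseteq> V" if "i < l" for i using that by (auto simp: V_def)
  have kV: "k \<le> card V" using card_mono[OF finV NV[of 0]] card_N \<open>l \<ge> 2\<close> by simp
  \<comment> \<open>Otherwise every \<open>N i\<close> equals the nonempty set \<open>V\<close>,
    against the empty intersection.\<close>
  have "m \<noteq> 0"
  proof
    assume "m = 0"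
    then have "N i = V" if "i < l" for i
      using card_subset_eq[OF finV NV[OF that]] card_N that kV by (simp add: m_def)
    then have "V \<subseteq> (\<Inter>i\<in>{..<l}. N i)" by auto
    then have "V = {}" using empty_inter by simp
    then show False using kV \<open>k \<ge> 3\<close> by simp
  qed
  then have "0 < m" by simp
  have "card V \<le> ((m + 1) choose 2) + 7 * m"
  proof (rule card_le_of_minimum_transversals[of "{..<l}" V "\<lambda>i. V - N i"])
    show "V = (\<Union>i\<in>{..<l}. V - N i)" using empty_inter by blast
    show "card (V - N i) = m" if "i \<in> {..<l}" for i
      using that card_N NV by (simp add: card_Diff_subset m_def)
    fix Z :: "'a set" assume Z: "finite Z" "card Z < m"
    \<comment> \<open>At most \<open>m - 1\<close> of the \<open>k + m\<close> vertices are removed,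
      so the clique condition applies to the rest. A triple not inside \<open>N i\<close> is one
      that meets the complement of \<open>N i\<close>.\<close>
    have "k + 1 \<le> card (V - Z)" using diff_card_le_card_Diff[OF Z(1), of V] Z(2) by (simp add: m_def)
    then obtain T where T: "T \<subseteq> V - Z" "card T = 3" "\<forall>i<l. \<not> T \<subseteq> N i"
      using no_big_clique[rule_format, of "V - Z"] by (auto simp: V_def)
    then have "\<forall>i\<in>{..<l}. T \<inter> (V - N i) \<noteq> {}" by blast
    then show "\<exists>T\<subseteq>V - Z. card T = 3 \<and> (\<forall>i\<in>{..<l}. T \<inter> (V - N i) \<noteq> {})" using T by blast
  qed (use finV \<open>0 < m\<close> in auto)
  \<comment> \<open>Passing to the larger binomial coefficient absorbs \<open>m + 1\<close>, leaving
    \<open>6 * m - 1\<close>, which is at most \<open>9 * m - 3\<close> since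
    \<open>m \<ge> 1\<close>.\<close>
  moreover have "(m + 2) choose 2 = ((m + 1) choose 2) + (m + 1)"
    by (simp add: numeral_2_eq_2)
  ultimately have "card V + 1 \<le> ((m + 2) choose 2) + 6 * m" by simp
  then have "real (card V) \<le> real ((m + 2) choose 2) + 6 * real m - 1" by linarith
  moreover have "0 \<le> real m powr (5/3)" "0 \<le> real m powr (4/3)" by simp_all
  ultimately have "real (card V) \<le> real ((m + 2) choose 2) + 6 * real m powr (5/3)
      + 3 * real m powr (4/3) + 9 * real m - 3"
    using \<open>0 < m\<close> by linarith
  then show ?thesis by (simp add: Let_def V_def m_def)
qed

end
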